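(* Let $(f,Q,\xi_i,\eta^i,g)$, $1\le i\le p$, be a metric weak $f$-structure on a smooth manifold $M^{2n+p}$. Then $(f,Q,\xi_i,\eta^i,g)$ is a weak ${\cal S}$-structure if and only if it is an ${\cal S}$-structure.
   Context: A metric weak $f$-structure $(f,Q,\xi_i,\eta^i,g)$, $1\le i\le p$, on a smooth manifold $M$ of dimension $2n+p$ ($p\ge 1$) consists of: a $(1,1)$-tensor field $f$ of constant rank $2n$ and a nonsingular $(1,1)$-tensor field $Q$ with $f^3+fQ=0$ and $Q\xi=\xi$ for $\xi\in\ker f$; global vector fields $\xi_1,\dots,\xi_p$ spanning $\ker f$ (assumed parallelizable) and dual one-forms $\eta^1,\dots,\eta^p$ with $f^2=-Q+\sum_i\eta^i\otimes\xi_i$, $\eta^i(\xi_j)=\delta^i_j$; and a Riemannian metric $g$ with $g(\xi_i,\xi_i)=1$ and $g(fX,fY)=g(X,QY)-\sum_i\eta^i(X)\,\eta^i(QY)$ for all vector fields $X,Y$. Then $g(X,\xi_i)=\eta^i(X)$, $f(TM)=\bigcap_i\ker\eta^i$ and $f(TM)\perp\ker f$. Notation: $2\,d\eta^i(X,Y)=X(\eta^i(Y))-Y(\eta^i(X))-\eta^i([X,Y])$; $[f,f](X,Y)=f^2[X,Y]+[fX,fY]-f[fX,Y]-f[X,fY]$; $\Phi(X,Y)=g(X,fY)$. The structure is normal if $N^{(1)}:=[f,f]+2\sum_i d\eta^i\otimes\xi_i=0$. A weak ${\cal S}$-structure is a normal metric weak $f$-structure with $d\eta^i=\Phi$ for all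 $1\le i\le p$ (so $d\Phi=0$). An ${\cal S}$-structure is a weak ${\cal S}$-structure with $Q={\rm id}_{TM}$ (the classical notion). *)

theory Defs
  imports "HOL-Analysis.Analysis" "HOL-Library.Function_Algebras"
begin

section \<open>Pointwise real vector space structure on function types\<close>

instantiation "fun" :: (type, real_vector) real_vector
begin

definition scaleR_fun :: "real \<Rightarrow> ('a \<Rightarrow> 'b) \<Rightarrow> 'a \<Rightarrow> 'b" where
  "scaleR_fun c F = (\<lambda>x. c *\<^sub>R F x)"

instance
  by standard (auto simp: scaleR_fun_def plus_fun_def fun_eq_iff
      scaleR_add_right scaleR_add_left)

end

definition linear_between :: "'a::real_vector set \<Rightarrow> 'b::real_vector set \<Rightarrow> ('a \<Rightarrow> 'b) \<Rightarrow> bool" where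
  "linear_between V W F \<longleftrightarrow>
     F ` V \<subseteq> W \<and>
     (\<forall>u\<in>V. \<forall>v\<in>V. F (u + v) = F u + F v) \<and>
     (\<forall>c. \<forall>v\<in>V. F (c *\<^sub>R v) = c *\<^sub>R F v)"

text \<open>
  The library function \<^const>\<open>dim\<close> returns 0 on infinite-dimensional spaces;
  the following predicate asserts finite-dimensionality as well.
\<close>

definition has_dim :: "'a::real_vector set \<Rightarrow> nat \<Rightarrow> bool" where
  "has_dim V d \<longleftrightarrow> (\<exists>B. finite B \<and> independent B \<and> span B = V \<and> card B = d)"


section \<open>Smooth manifolds\<close>

text \<open>Both notions below are meant for open \<open>S\<close>.\<close>

primrec Ck_on :: "nat \<Rightarrow> 'a::real_normed_vector set \<Rightarrow> ('a \<Rightarrow> 'b::real_normed_vector) \<Rightarrow> bool" where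
  "Ck_on 0 S h \<longleftrightarrow> continuous_on S h"
| "Ck_on (Suc k) S h \<longleftrightarrow>
     (\<forall>x\<in>S. h differentiable (at x)) \<and>
     (\<forall>v. Ck_on k S (\<lambda>x. frechet_derivative h (at x) v))"

definition smooth_on :: "'a::real_normed_vector set \<Rightarrow> ('a \<Rightarrow> 'b::real_normed_vector) \<Rightarrow> bool" where
  "smooth_on S h \<longleftrightarrow> (\<forall>k. Ck_on k S h)"

text \<open>
  A manifold is a Hausdorff, second countable space \<open>'m\<close> with a smooth atlas modelled on
  a Euclidean space \<open>'e\<close>. A chart is a pair of its domain and its coordinate map (whose
  values outside the domain are irrelevant). The atlas need not be maximal: the smooth
  functions, and everything derived from them, depend only on the smooth structure that
  it generates.
\<close>

type_synonym ('m, 'e) chart = "'m set \<times> ('m \<Rightarrow> 'e)"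

definition is_chart :: "('m::topological_space, 'e::euclidean_space) chart \<Rightarrow> bool" where
  "is_chart c \<longleftrightarrow> (case c of (U, \<phi>) \<Rightarrow>
     open U \<and> open (\<phi> ` U) \<and> homeomorphism U (\<phi> ` U) \<phi> (inv_into U \<phi>))"

definition smooth_atlas ::
  "('m::{t2_space,second_countable_topology}, 'e::euclidean_space) chart set \<Rightarrow> bool" where
  "smooth_atlas A \<longleftrightarrow>
     (\<forall>c\<in>A. is_chart c) \<and>
     (\<Union>(U, \<phi>)\<in>A. U) = UNIV \<and>
     (\<forall>(U, \<phi>)\<in>A. \<forall>(V, \<psi>)\<in>A. smooth_on (\<phi> ` (U \<inter> V)) (\<psi> \<circ> inv_into U \<phi>))"

definition smooth_manifold ::
  "('m::{t2_space,second_countable_topology}, 'e::euclidean_space) chart set \<Rightarrow> nat \<Rightarrow> bool" where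
  "smooth_manifold A d \<longleftrightarrow> smooth_atlas A \<and> DIM('e) = d"

definition smooth_fun :: "('m, 'e::euclidean_space) chart set \<Rightarrow> ('m \<Rightarrow> real) \<Rightarrow> bool" where
  "smooth_fun A h \<longleftrightarrow> (\<forall>(U, \<phi>)\<in>A. smooth_on (\<phi> ` U) (h \<circ> inv_into U \<phi>))"


section \<open>Tangent spaces and tensor fields\<close>

text \<open>
  Tangent vectors at \<open>x\<close> are the derivations at \<open>x\<close> of the algebra of smooth functions.
  They are extended by 0 to non-smooth functions, so that a derivation is represented by
  exactly one function and addition and scaling are the pointwise operations.
\<close>

type_synonym 'm tvec = "('m \<Rightarrow> real) \<Rightarrow> real"

definition tangent_space :: "('m, 'e::euclidean_space) chart set \<Rightarrow> 'm \<Rightarrow> 'm tvec set" where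
  "tangent_space A x = {v.
     (\<forall>h k. smooth_fun A h \<longrightarrow> smooth_fun A k \<longrightarrow> v (\<lambda>y. h y + k y) = v h + v k) \<and>
     (\<forall>c h. smooth_fun A h \<longrightarrow> v (\<lambda>y. c * h y) = c * v h) \<and>
     (\<forall>h k. smooth_fun A h \<longrightarrow> smooth_fun A k \<longrightarrow> v (\<lambda>y. h y * k y) = h x * v k + k x * v h) \<and>
     (\<forall>h. \<not> smooth_fun A h \<longrightarrow> v h = 0)}"

text \<open>
  Tensor fields are families of maps indexed by the points of the manifold; their values
  on arguments outside the tangent space at the point are irrelevant. Smoothness is
  tested on smooth vector fields.
\<close>

type_synonym 'm vfield = "'m \<Rightarrow> 'm tvec"
type_synonym 'm tensor11 = "'m \<Rightarrow> 'm tvec \<Rightarrow> 'm tvec"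
type_synonym 'm form1 = "'m \<Rightarrow> 'm tvec \<Rightarrow> real"
type_synonym 'm tensor02 = "'m \<Rightarrow> 'm tvec \<Rightarrow> 'm tvec \<Rightarrow> real"

definition vector_field :: "('m, 'e::euclidean_space) chart set \<Rightarrow> 'm vfield \<Rightarrow> bool" where
  "vector_field A X \<longleftrightarrow>
     (\<forall>x. X x \<in> tangent_space A x) \<and>
     (\<forall>h. smooth_fun A h \<longrightarrow> smooth_fun A (\<lambda>x. X x h))"

definition app :: "'m tensor11 \<Rightarrow> 'm vfield \<Rightarrow> 'm vfield" where
  "app F X = (\<lambda>x. F x (X x))"

definition tensor11_field :: "('m, 'e::euclidean_space) chart set \<Rightarrow> 'm tensor11 \<Rightarrow> bool" where
  "tensor11_field A F \<longleftrightarrow>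
     (\<forall>x. linear_between (tangent_space A x) (tangent_space A x) (F x)) \<and>
     (\<forall>X. vector_field A X \<longrightarrow> vector_field A (app F X))"

definition one_form :: "('m, 'e::euclidean_space) chart set \<Rightarrow> 'm form1 \<Rightarrow> bool" where
  "one_form A \<alpha> \<longleftrightarrow>
     (\<forall>x. linear_between (tangent_space A x) UNIV (\<alpha> x)) \<and>
     (\<forall>X. vector_field A X \<longrightarrow> smooth_fun A (\<lambda>x. \<alpha> x (X x)))"

definition riemannian_metric :: "('m, 'e::euclidean_space) chart set \<Rightarrow> 'm tensor02 \<Rightarrow> bool" where
  "riemannian_metric A g \<longleftrightarrow>
     (\<forall>x. \<forall>u\<in>tangent_space A x. linear_between (tangent_space A x) UNIV (g x u)) \<and>
     (\<forall>x. \<forall>u\<in>tangent_space A x. \<forall>v\<in>tangent_space A x. g x u v = g x v u) \<and>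
     (\<forall>x. \<forall>u\<in>tangent_space A x. u \<noteq> 0 \<longrightarrow> g x u u > 0) \<and>
     (\<forall>X Y. vector_field A X \<longrightarrow> vector_field A Y \<longrightarrow> smooth_fun A (\<lambda>x. g x (X x) (Y x)))"

text \<open>
  \<open>[X,Y] h = X (Y h) - Y (X h)\<close>. For non-smooth \<open>h\<close> both \<open>X h\<close> and \<open>Y h\<close> are the zero
  function, so the value is 0, as required by \<^const>\<open>tangent_space\<close>.
\<close>

definition lie_bracket :: "'m vfield \<Rightarrow> 'm vfield \<Rightarrow> 'm vfield" where
  "lie_bracket X Y = (\<lambda>x h. X x (\<lambda>y. Y y h) - Y x (\<lambda>y. X y h))"

text \<open>The exterior derivative carries the factor 1/2.\<close>

definition ext_deriv :: "'m form1 \<Rightarrow> 'm vfield \<Rightarrow> 'm vfield \<Rightarrow> 'm \<Rightarrow> real" where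
  "ext_deriv \<alpha> X Y x =
     (X x (\<lambda>y. \<alpha> y (Y y)) - Y x (\<lambda>y. \<alpha> y (X y)) - \<alpha> x (lie_bracket X Y x)) / 2"

definition nijenhuis :: "'m tensor11 \<Rightarrow> 'm vfield \<Rightarrow> 'm vfield \<Rightarrow> 'm vfield" where
  "nijenhuis F X Y =
     app F (app F (lie_bracket X Y)) + lie_bracket (app F X) (app F Y)
     - app F (lie_bracket (app F X) Y) - app F (lie_bracket X (app F Y))"


section \<open>Metric weak f-structures\<close>

definition metric_weak_f_structure ::
  "('m, 'e::euclidean_space) chart set \<Rightarrow> nat \<Rightarrow> nat \<Rightarrow> 'm tensor11 \<Rightarrow> 'm tensor11 \<Rightarrow>
     (nat \<Rightarrow> 'm vfield) \<Rightarrow> (nat \<Rightarrow> 'm form1) \<Rightarrow> 'm tensor02 \<Rightarrow> bool" where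
  "metric_weak_f_structure A n p f Q \<xi> \<eta> g \<longleftrightarrow>
     tensor11_field A f \<and>
     (\<forall>x. has_dim (f x ` tangent_space A x) (2 * n)) \<and>
     tensor11_field A Q \<and>
     (\<forall>x. bij_betw (Q x) (tangent_space A x) (tangent_space A x)) \<and>
     (\<forall>x. \<forall>v\<in>tangent_space A x. f x (f x (f x v)) + f x (Q x v) = 0) \<and>
     (\<forall>x. \<forall>v\<in>tangent_space A x. f x v = 0 \<longrightarrow> Q x v = v) \<and>
     (\<forall>i\<in>{1..p}. vector_field A (\<xi> i)) \<and>
     (\<forall>x. span ((\<lambda>i. \<xi> i x) ` {1..p}) = {v \<in> tangent_space A x. f x v = 0}) \<and>
     (\<forall>i\<in>{1..p}. one_form A (\<eta> i)) \<and>
     (\<forall>x. \<forall>v\<in>tangent_space A x. f x (f x v) = - Q x v + (\<Sum>i=1..p. \<eta> i x v *\<^sub>R \<xi> i x)) \<and>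
     (\<forall>x. \<forall>i\<in>{1..p}. \<forall>j\<in>{1..p}. \<eta> i x (\<xi> j x) = (if i = j then 1 else 0)) \<and>
     riemannian_metric A g \<and>
     (\<forall>x. \<forall>i\<in>{1..p}. g x (\<xi> i x) (\<xi> i x) = 1) \<and>
     (\<forall>X Y. vector_field A X \<longrightarrow> vector_field A Y \<longrightarrow>
        (\<forall>x. g x (f x (X x)) (f x (Y x)) =
             g x (X x) (Q x (Y x)) - (\<Sum>i=1..p. \<eta> i x (X x) * \<eta> i x (Q x (Y x)))))"

definition fundamental_form :: "'m tensor11 \<Rightarrow> 'm tensor02 \<Rightarrow> 'm tensor02" where
  "fundamental_form f g x u v = g x u (f x v)"

definition N1 :: "nat \<Rightarrow> 'm tensor11 \<Rightarrow> (nat \<Rightarrow> 'm vfield) \<Rightarrow> (nat \<Rightarrow> 'm form1) \<Rightarrow>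
    'm vfield \<Rightarrow> 'm vfield \<Rightarrow> 'm vfield" where
  "N1 p f \<xi> \<eta> X Y =
     (\<lambda>x. nijenhuis f X Y x + 2 *\<^sub>R (\<Sum>i=1..p. ext_deriv (\<eta> i) X Y x *\<^sub>R \<xi> i x))"

definition normal_structure :: "('m, 'e::euclidean_space) chart set \<Rightarrow> nat \<Rightarrow> 'm tensor11 \<Rightarrow>
    (nat \<Rightarrow> 'm vfield) \<Rightarrow> (nat \<Rightarrow> 'm form1) \<Rightarrow> bool" where
  "normal_structure A p f \<xi> \<eta> \<longleftrightarrow>
     (\<forall>X Y. vector_field A X \<longrightarrow> vector_field A Y \<longrightarrow> N1 p f \<xi> \<eta> X Y = 0)"

definition weak_S_structure ::
  "('m, 'e::euclidean_space) chart set \<Rightarrow> nat \<Rightarrow> nat \<Rightarrow> 'm tensor11 \<Rightarrow> 'm tensor11 \<Rightarrow>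
     (nat \<Rightarrow> 'm vfield) \<Rightarrow> (nat \<Rightarrow> 'm form1) \<Rightarrow> 'm tensor02 \<Rightarrow> bool" where
  "weak_S_structure A n p f Q \<xi> \<eta> g \<longleftrightarrow>
     metric_weak_f_structure A n p f Q \<xi> \<eta> g \<and>
     normal_structure A p f \<xi> \<eta> \<and>
     (\<forall>i\<in>{1..p}. \<forall>X Y. vector_field A X \<longrightarrow> vector_field A Y \<longrightarrow>
        (\<forall>x. ext_deriv (\<eta> i) X Y x = fundamental_form f g x (X x) (Y x)))"

definition S_structure ::
  "('m, 'e::euclidean_space) chart set \<Rightarrow> nat \<Rightarrow> nat \<Rightarrow> 'm tensor11 \<Rightarrow> 'm tensor11 \<Rightarrow>
     (nat \<Rightarrow> 'm vfield) \<Rightarrow> (nat \<Rightarrow> 'm form1) \<Rightarrow> 'm tensor02 \<Rightarrow> bool" where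
  "S_structure A n p f Q \<xi> \<eta> g \<longleftrightarrow>
     weak_S_structure A n p f Q \<xi> \<eta> g \<and>
     (\<forall>x. \<forall>v\<in>tangent_space A x. Q x v = v)"

end

theory Submission
  imports Defs
begin

text \<open>
  Every tangent vector is the value of a global vector field, so the conditions on vector
  fields hold pointwise. Compatibility of \<open>g\<close> with \<open>f\<close> gives \<open>\<eta>\<^sup>i = g(\<xi>\<^sub>i, \<cdot>)\<close>, and the
  antisymmetry of \<open>\<Phi> = d\<eta>\<^sup>i\<close> then gives \<open>\<eta>\<^sup>i \<circ> f = 0\<close>. Applying \<open>\<eta>\<^sup>1\<close> to the normality
  condition leaves \<open>\<eta>\<^sup>1[fX, fY] = - 2 \<Phi>(X, Y)\<close>, while \<open>\<eta>\<^sup>1[fX, fY] = - 2 d\<eta>\<^sup>1(fX, fY)\<close>, so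
  \<open>\<Phi>(fX, fY) = \<Phi>(X, Y)\<close>. By compatibility the left-hand side is \<open>g(X, QfY)\<close>; hence
  \<open>fQ = Qf = f\<close>. Thus \<open>QY - Y\<close> lies in \<open>ker f\<close>, and it is annihilated by all \<open>\<eta>\<^sup>i\<close>, so it vanishes.
\<close>

section \<open>Calculus of \<open>C\<^sup>k\<close> functions\<close>

text \<open>Openness turns equality on \<open>S\<close> into equality near each point, so both
  functions have the same Frechet derivatives there and the induction passes to those.\<close>

lemma Ck_on_cong:
  assumes "open S" "\<And>x. x \<in> S \<Longrightarrow> h x = h' x" "Ck_on k S h"
  shows "Ck_on k S h'"
  using assms(2,3)
proof (induction k arbitrary: h h')
  case 0
  then show ?case by (auto cong: continuous_on_cong)
next
  case (Suc k)
  have d: "(h' has_derivative frechet_derivative h (at x)) (at x)" if "x \<in> S" for x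
    using Suc.prems that assms(1)
    by (metis Ck_on.simps(2) frechet_derivative_works has_derivative_transform_within_open)
  then have e: "frechet_derivative h (at x) = frechet_derivative h' (at x)" if "x \<in> S" for x
    using that by (simp add: frechet_derivative_at)
  have "Ck_on k S (\<lambda>x. frechet_derivative h' (at x) v)" for v
    by (rule Suc.IH[of "\<lambda>x. frechet_derivative h (at x) v"]) (use e Suc.prems in auto)
  with d show ?case
    by (auto simp: differentiable_def)
qed

text \<open>Lets an explicit derivative \<open>D\<close> stand in for
  \<open>frechet_derivative\<close>, which agrees with it on \<open>S\<close> by uniqueness of
  derivatives.\<close>

lemma Ck_on_SucI:
  assumes "open S" "\<And>x. x \<in> S \<Longrightarrow> (h has_derivative D x) (at x)"
    and "\<And>v. Ck_on k S (\<lambda>x. D x v)"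
  shows "Ck_on (Suc k) S h"
proof -
  have "Ck_on k S (\<lambda>x. frechet_derivative h (at x) v)" for v
    by (rule Ck_on_cong[OF assms(1) _ assms(3)[of v]])
      (use assms(2) in \<open>metis frechet_derivative_at\<close>)
  with assms(2) show ?thesis
    by (auto simp: differentiable_def)
qed

lemma Ck_on_imp_continuous_on: "Ck_on k S h \<Longrightarrow> continuous_on S h"
  by (cases k)
    (auto intro!: continuous_at_imp_continuous_on differentiable_imp_continuous_within)

lemma Ck_on_SucD: "Ck_on (Suc k) S h \<Longrightarrow> Ck_on k S h"
proof (induction k arbitrary: h)
  case 0
  then show ?case using Ck_on_imp_continuous_on[OF 0] by simp
next
  case (Suc k)
  then show ?case by (metis Ck_on.simps(2))
qed

lemma Ck_on_subset: "Ck_on k S h \<Longrightarrow> T \<subseteq> S \<Longrightarrow> Ck_on k T h"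
  by (induction k arbitrary: h) (auto intro: continuous_on_subset)

text \<open>Differentiability at a point does not refer to the set, so gluing over the open sets is
  an issue only for continuity at \<open>k = 0\<close>.\<close>

lemma Ck_on_Un:
  assumes "open S" "open T" "Ck_on k S h" "Ck_on k T h"
  shows "Ck_on k (S \<union> T) h"
  using assms(3,4)
  by (induction k arbitrary: h) (auto intro: continuous_on_open_Un assms(1,2))

lemma has_derivative_frechet:
  assumes "Ck_on (Suc k) S h" "x \<in> S"
  shows "(h has_derivative frechet_derivative h (at x)) (at x)"
  using assms frechet_derivative_works by fastforce

lemma Ck_on_const: "open S \<Longrightarrow> Ck_on k S (\<lambda>x. c)"
proof (induction k arbitrary: c)
  case (Suc k)
  show ?case
    by (rule Ck_on_SucI[where D = "\<lambda>x v. 0"]) (use Suc in auto)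
qed simp

lemma Ck_on_bounded_linear:
  assumes "open S" "bounded_linear l"
  shows "Ck_on k S l"
proof (cases k)
  case 0
  then show ?thesis
    using assms(2) linear_continuous_on by auto
next
  case (Suc m)
  have "Ck_on (Suc m) S l"
    by (rule Ck_on_SucI[where D = "\<lambda>x. l"])
      (use assms in \<open>auto intro: bounded_linear_imp_has_derivative Ck_on_const\<close>)
  with Suc show ?thesis by simp
qed

lemma Ck_on_bounded_linear_comp:
  assumes "open S" "bounded_linear l" "Ck_on k S h"
  shows "Ck_on k S (\<lambda>x. l (h x))"
  using assms(3)
proof (induction k arbitrary: h)
  case 0
  then show ?case
    using assms(2) by (auto intro: bounded_linear.continuous_on)
next
  case (Suc k)
  show ?case
  proof (rule Ck_on_SucI[OF assms(1)])
    show "((\<lambda>x. l (h x)) has_derivative (\<lambda>v. l (frechet_derivative h (at x) v))) (at x)"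
      if "x \<in> S" for x
      by (rule bounded_linear.has_derivative[OF assms(2) has_derivative_frechet[OF Suc.prems that]])
    show "Ck_on k S (\<lambda>x. l (frechet_derivative h (at x) v))" for v
      using Suc by simp
  qed
qed

lemma Ck_on_add:
  assumes "open S" "Ck_on k S h" "Ck_on k S h'"
  shows "Ck_on k S (\<lambda>x. h x + h' x)"
  using assms(2,3)
proof (induction k arbitrary: h h')
  case 0
  then show ?case by (auto intro: continuous_intros)
next
  case (Suc k)
  show ?case
  proof (rule Ck_on_SucI[OF assms(1)])
    show "((\<lambda>x. h x + h' x) has_derivative
        (\<lambda>v. frechet_derivative h (at x) v + frechet_derivative h' (at x) v)) (at x)"
      if "x \<in> S" for x
      by (rule has_derivative_add[OF Suc.prems(1)[THEN has_derivative_frechet, OF that]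
          Suc.prems(2)[THEN has_derivative_frechet, OF that]])
    show "Ck_on k S (\<lambda>x. frechet_derivative h (at x) v + frechet_derivative h' (at x) v)" for v
      using Suc by simp
  qed
qed

lemma Ck_on_sum:
  assumes "open S" "\<And>i. i \<in> I \<Longrightarrow> Ck_on k S (h i)"
  shows "Ck_on k S (\<lambda>x. \<Sum>i\<in>I. h i x)"
  using assms(2)
  by (induction I rule: infinite_finite_induct) (auto intro: Ck_on_const Ck_on_add assms(1))

lemma Ck_on_mult:
  fixes h h' :: "'a::real_normed_vector \<Rightarrow> real"
  assumes "open S" "Ck_on k S h" "Ck_on k S h'"
  shows "Ck_on k S (\<lambda>x. h x * h' x)"
  using assms(2,3)
proof (induction k arbitrary: h h')
  case 0
  then show ?case by (auto intro: continuous_intros)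
next
  case (Suc k)
  show ?case
  proof (rule Ck_on_SucI[OF assms(1)])
    show "((\<lambda>x. h x * h' x) has_derivative
        (\<lambda>v. h x * frechet_derivative h' (at x) v + frechet_derivative h (at x) v * h' x)) (at x)"
      if "x \<in> S" for x
      by (rule has_derivative_mult[OF Suc.prems(1)[THEN has_derivative_frechet, OF that]
          Suc.prems(2)[THEN has_derivative_frechet, OF that]])
    show "Ck_on k S (\<lambda>x. h x * frechet_derivative h' (at x) v + frechet_derivative h (at x) v * h' x)"
      for v
      \<comment> \<open>Each summand of the product rule keeps an undifferentiated factor, so the
        premises are also lowered from \<open>Suc k\<close> to \<open>k\<close>.\<close>
      using Suc.prems Suc.prems[THEN Ck_on_SucD] by (intro Ck_on_add assms(1) Suc.IH) simp_all
  qed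
qed

lemma linear_eq_sum_Basis:
  fixes l :: "'a::euclidean_space \<Rightarrow> real"
  assumes "linear l"
  shows "l v = (\<Sum>b\<in>Basis. (v \<bullet> b) * l b)"
  using linear_sum[OF assms, of "\<lambda>b. (v \<bullet> b) *\<^sub>R b" Basis] linear_scale[OF assms]
  by (simp add: euclidean_representation)

text \<open>In the chain rule the direction fed to the derivative of \<open>h\<close> moves with
  \<open>x\<close>, while \<open>Ck_on\<close> controls only fixed directions. Expanding in the
  basis leaves fixed directions \<open>b\<close> with real coefficients, to which the sum and
  product rules apply.\<close>

lemma Ck_on_compose:
  fixes \<tau> :: "'a::real_normed_vector \<Rightarrow> 'b::euclidean_space" and h :: "'b \<Rightarrow> real"
  assumes "open S" "\<tau> ` S \<subseteq> T" "Ck_on k S \<tau>" "Ck_on k T h"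
  shows "Ck_on k S (\<lambda>x. h (\<tau> x))"
  using assms(3,4)
proof (induction k arbitrary: h)
  case 0
  then show ?case
    using assms(2) by (auto intro: continuous_on_compose2)
next
  case (Suc k)
  let ?Dh = "\<lambda>y. frechet_derivative h (at y)" and ?D\<tau> = "\<lambda>x. frechet_derivative \<tau> (at x)"
  have Dh: "(h has_derivative ?Dh (\<tau> x)) (at (\<tau> x))" if "x \<in> S" for x
    using that assms(2) by (intro has_derivative_frechet[OF Suc.prems(2)]) auto
  show ?case
  proof (rule Ck_on_SucI[OF assms(1)])
    show "((\<lambda>x. h (\<tau> x)) has_derivative
        (\<lambda>v. \<Sum>b\<in>Basis. (?D\<tau> x v \<bullet> b) * ?Dh (\<tau> x) b)) (at x)" if "x \<in> S" for x
    proof (rule has_derivative_eq_rhs)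
      show "((\<lambda>x. h (\<tau> x)) has_derivative (\<lambda>v. ?Dh (\<tau> x) (?D\<tau> x v))) (at x)"
        by (rule has_derivative_compose[OF has_derivative_frechet[OF Suc.prems(1) that] Dh[OF that]])
      show "(\<lambda>v. ?Dh (\<tau> x) (?D\<tau> x v)) = (\<lambda>v. \<Sum>b\<in>Basis. (?D\<tau> x v \<bullet> b) * ?Dh (\<tau> x) b)"
        by (rule ext, rule linear_eq_sum_Basis[OF has_derivative_linear[OF Dh[OF that]]])
    qed
    show "Ck_on k S (\<lambda>x. \<Sum>b\<in>Basis. (?D\<tau> x v \<bullet> b) * ?Dh (\<tau> x) b)" for v
      using Suc.prems Ck_on_SucD[OF Suc.prems(1)]
      by (intro Ck_on_sum Ck_on_mult assms(1) Suc.IH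
          Ck_on_bounded_linear_comp[OF assms(1) bounded_linear_inner_left]) simp_all
  qed
qed

section \<open>Flat functions and bump functions\<close>

text \<open>For \<open>m = 0\<close> this is the classical smooth function exp(-1/t), flat at the
  origin; the powers of 1/t make the linear span of the family closed under differentiation.\<close>

definition exp_flat :: "nat \<Rightarrow> real \<Rightarrow> real" where
  "exp_flat m t = (if t > 0 then exp (- inverse t) * inverse t ^ m else 0)"

text \<open>On the right the substitution s = 1/t reduces the limit to s^m / exp s at infinity; on
  the left the function is zero.\<close>

lemma exp_flat_tendsto_0: "(exp_flat m \<longlongrightarrow> 0) (at 0)"
proof -
  have "((\<lambda>t. (inverse t) ^ m / exp (inverse t)) \<longlongrightarrow> 0) (at_right (0::real))"
    by (rule filterlim_compose[OF tendsto_power_div_exp_0 filterlim_inverse_at_top_right])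
  moreover have "eventually (\<lambda>t. inverse t ^ m / exp (inverse t) = exp_flat m t) (at_right (0::real))"
    unfolding eventually_at_right_field
    by (intro exI[of _ 1]) (simp add: exp_flat_def exp_minus divide_inverse mult.commute)
  ultimately have 1: "(exp_flat m \<longlongrightarrow> 0) (at_right 0)"
    by (rule Lim_transform_eventually)
  have "eventually (\<lambda>t. 0 = exp_flat m t) (at_left (0::real))"
    unfolding eventually_at_left_field
    by (intro exI[of _ "-1"]) (auto simp: exp_flat_def)
  then have "(exp_flat m \<longlongrightarrow> 0) (at_left 0)"
    by (rule Lim_transform_eventually[OF tendsto_const])
  with 1 show ?thesis by (rule filterlim_split_at[rotated])
qed

lemma exp_flat_has_derivative:
  "(exp_flat m has_real_derivative (exp_flat (m + 2) t - m * exp_flat (m + 1) t)) (at t)"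
proof -
  consider "t > 0" | "t < 0" | "t = 0" by linarith
  then show ?thesis
  proof cases
    case 1
    let ?s = "inverse t"
    have "((\<lambda>t. exp (- inverse t) * inverse t ^ m) has_real_derivative
        exp (- ?s) * ?s\<^sup>2 * ?s ^ m - exp (- ?s) * (real m * ?s ^ (m - 1)) * ?s\<^sup>2) (at t)"
      using 1 by (auto intro!: derivative_eq_intros simp: power2_eq_square)
    \<comment> \<open>For \<open>m = 0\<close> the exponent \<open>m - 1\<close> is truncated to 0,
      which the factor \<open>real m\<close> makes harmless.\<close>
    moreover have "real m * ?s ^ (m - 1) * ?s\<^sup>2 = real m * ?s ^ (m + 1)"
      by (cases m) (simp_all add: power2_eq_square)
    then have "exp (- ?s) * (real m * ?s ^ (m - 1)) * ?s\<^sup>2 = exp (- ?s) * (real m * ?s ^ (m + 1))"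
      by (simp only: mult.assoc)
    moreover have "exp (- ?s) * ?s\<^sup>2 * ?s ^ m - exp (- ?s) * (real m * ?s ^ (m + 1))
        = exp_flat (m + 2) t - m * exp_flat (m + 1) t"
      using 1 by (simp add: exp_flat_def power2_eq_square)
    ultimately have "((\<lambda>t. exp (- inverse t) * inverse t ^ m) has_real_derivative
        (exp_flat (m + 2) t - m * exp_flat (m + 1) t)) (at t)"
      by (simp only:)
    then show ?thesis
      by (rule has_field_derivative_transform_within_open[where S = "{0<..}"])
        (use 1 in \<open>auto simp: exp_flat_def\<close>)
  next
    case 2
    have "(exp_flat m has_real_derivative 0) (at t)"
      by (rule has_field_derivative_transform_within_open[where f = "\<lambda>t. 0" and S = "{..<0}"])
        (use 2 in \<open>auto simp: exp_flat_def\<close>)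
    with 2 show ?thesis
      by (simp add: exp_flat_def[of _ t])
  next
    case 3
    \<comment> \<open>The difference quotient at the origin is the next member of the family, whose
      limit is already known to be 0.\<close>
    have "exp_flat m y / y = exp_flat (m + 1) y" if "y \<noteq> 0" for y
      using that by (auto simp: exp_flat_def field_simps)
    then have "((\<lambda>y. (exp_flat m y - exp_flat m 0) / (y - 0)) \<longlongrightarrow> 0) (at 0)"
      by (intro Lim_transform_eventually[OF exp_flat_tendsto_0[of "m + 1"]])
        (simp add: eventually_at_filter exp_flat_def[of m 0])
    then show ?thesis
      using 3 by (simp add: has_field_derivative_iff exp_flat_def[of _ 0])
  qed
qed

text \<open>The index \<open>m\<close> stays arbitrary in the induction because differentiation
  raises it by 1 and 2.\<close>

lemma Ck_on_exp_flat: "Ck_on k UNIV (exp_flat m)"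
proof (induction k arbitrary: m)
  case 0
  show ?case
    by (simp add: continuous_at_imp_continuous_on DERIV_isCont[OF exp_flat_has_derivative])
next
  case (Suc k)
  show ?case
  proof (rule Ck_on_SucI[OF open_UNIV])
    show "(exp_flat m has_derivative (\<lambda>v. (exp_flat (m + 2) t + (- real m) * exp_flat (m + 1) t) * v)) (at t)" for t
      using exp_flat_has_derivative[of m t] by (simp add: has_field_derivative_def)
    show "Ck_on k UNIV (\<lambda>t. (exp_flat (m + 2) t + (- real m) * exp_flat (m + 1) t) * v)" for v
      by (intro Ck_on_mult Ck_on_add Ck_on_const Suc open_UNIV)
  qed
qed

text \<open>For \<open>r > 0\<close> this is positive exactly on the open ball of radius
  \<open>r\<close> about \<open>a\<close>. The squared distance keeps the argument polynomial, hence
  smooth even at the centre.\<close>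

definition bump :: "'e::euclidean_space \<Rightarrow> real \<Rightarrow> 'e \<Rightarrow> real" where
  "bump a r z = exp_flat 0 (r\<^sup>2 - (z - a) \<bullet> (z - a))"

lemma bump_eq_0:
  assumes "dist a z \<ge> r" "r > 0"
  shows "bump a r z = 0"
proof -
  have "r\<^sup>2 \<le> (norm (z - a))\<^sup>2"
    using assms by (intro power_mono) (simp_all add: dist_norm norm_minus_commute)
  then show ?thesis
    by (simp add: bump_def exp_flat_def power2_norm_eq_inner)
qed

lemma bump_centre_pos: "r > 0 \<Longrightarrow> bump a r a > 0"
  by (auto simp: bump_def exp_flat_def)

lemma Ck_on_bump:
  assumes "open S"
  shows "Ck_on k S (bump a r)"
proof -
  have "Ck_on k S (\<lambda>z. z - a)"
    using Ck_on_add[OF assms Ck_on_bounded_linear[OF assms bounded_linear_ident] Ck_on_const[OF assms, of k "-a"]]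
    by simp
  then have "Ck_on k S (\<lambda>z. (z - a) \<bullet> b)" for b
    by (intro Ck_on_bounded_linear_comp[OF assms bounded_linear_inner_left])
  \<comment> \<open>The squared distance is expanded in coordinates, where the product rule for real
    factors applies.\<close>
  then have "Ck_on k S (\<lambda>z. r\<^sup>2 + (\<Sum>b\<in>Basis. -1 * (((z - a) \<bullet> b) * ((z - a) \<bullet> b))))"
    by (intro Ck_on_add Ck_on_sum Ck_on_mult Ck_on_const assms)
  moreover have "r\<^sup>2 + (\<Sum>b\<in>Basis. -1 * (((z - a) \<bullet> b) * ((z - a) \<bullet> b))) = r\<^sup>2 - (z - a) \<bullet> (z - a)" for z
    unfolding sum_distrib_left[symmetric] euclidean_inner[of "z - a" "z - a", symmetric] by simp
  ultimately have q: "Ck_on k S (\<lambda>z. r\<^sup>2 - (z - a) \<bullet> (z - a))"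
    by (simp only:)
  show ?thesis
    unfolding bump_def[abs_def]
    by (rule Ck_on_compose[OF assms subset_UNIV q Ck_on_exp_flat])
qed

section \<open>Integrals along segments and Hadamard's lemma\<close>

text \<open>Differentiating under the integral sign produces a factor \<open>t\<close>, which the weight \<open>w\<close>
  absorbs in the induction on \<open>k\<close>.\<close>

lemma Ck_on_integral_segment:
  fixes h :: "'e::euclidean_space \<Rightarrow> real"
  assumes "Ck_on k (ball a R) h" "continuous_on {0..1} w"
  shows "Ck_on k (ball a R) (\<lambda>z. integral {0..1} (\<lambda>t. w t * h (a + t *\<^sub>R (z - a))))"
  using assms
proof (induction k arbitrary: w h)
  have seg: "a + t *\<^sub>R (z - a) \<in> ball a R" if "z \<in> ball a R" "0 \<le> t" "t \<le> 1" for z t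
    using that mult_left_le_one_le[of "dist a z" t]
    by (auto simp: dist_norm norm_minus_commute)
  have cont: "continuous_on (ball a R \<times> cbox 0 1) (\<lambda>(z, t). w t * h (a + t *\<^sub>R (z - a)))"
    if "continuous_on (ball a R) h" "continuous_on {0..1} w" for h :: "'e \<Rightarrow> real" and w :: "real \<Rightarrow> real"
  proof -
    have "continuous_on (ball a R \<times> cbox 0 1) (\<lambda>p. w (snd p))"
      by (rule continuous_on_compose2[OF that(2) continuous_on_snd[OF continuous_on_id]]) auto
    moreover have "continuous_on (ball a R \<times> cbox 0 1) (\<lambda>p. a + snd p *\<^sub>R (fst p - a))"
      by (intro continuous_intros)
    then have "continuous_on (ball a R \<times> cbox 0 1) (\<lambda>p. h (a + snd p *\<^sub>R (fst p - a)))"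
      by (rule continuous_on_compose2[OF that(1)]) (use seg in force)
    ultimately show ?thesis
      unfolding case_prod_unfold by (rule continuous_on_mult)
  qed
  {
    case 0
    have "continuous_on (ball a R) (\<lambda>z. integral (cbox 0 1) (\<lambda>t. w t * h (a + t *\<^sub>R (z - a))))"
      using 0 by (intro integral_continuous_on_param cont) auto
    then show ?case by simp
  next
    case (Suc k)
    let ?D = "\<lambda>z. frechet_derivative h (at z)"
    have D: "(h has_derivative ?D z) (at z)" if "z \<in> ball a R" for z
      by (rule has_derivative_frechet[OF Suc.prems(1) that])
    have Dc: "continuous_on (ball a R) (\<lambda>z. ?D z v)" for v
      using Suc.prems(1) by (intro Ck_on_imp_continuous_on[of k]) simp
    \<comment> \<open>\<open>B z t\<close> is the derivative in \<open>z\<close> of the integrand at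
      parameter \<open>t\<close>, packaged as a bounded linear operator so that the Leibniz rule can
      integrate it over \<open>t\<close>.\<close>
    define B where "B = (\<lambda>z t. Blinfun (\<lambda>v. w t * (t * ?D (a + t *\<^sub>R (z - a)) v)))"
    have B: "blinfun_apply (B z t) = (\<lambda>v. w t * (t * ?D (a + t *\<^sub>R (z - a)) v))"
      if "z \<in> ball a R" "t \<in> cbox 0 1" for z t
      unfolding B_def
      by (rule bounded_linear_Blinfun_apply)
        (use that seg in \<open>auto intro!: bounded_linear_mult_const bounded_linear_const_mult
          has_derivative_bounded_linear[OF D]\<close>)
    have fx: "((\<lambda>z. w t * h (a + t *\<^sub>R (z - a))) has_derivative blinfun_apply (B z t))
        (at z within ball a R)" if "z \<in> ball a R" "t \<in> cbox 0 1" for z t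
    proof -
      have "((\<lambda>z. a + t *\<^sub>R (z - a)) has_derivative (\<lambda>v. t *\<^sub>R v)) (at z within ball a R)"
        by (auto intro!: derivative_eq_intros)
      moreover have "(h has_derivative ?D (a + t *\<^sub>R (z - a))) (at (a + t *\<^sub>R (z - a)))"
        using that by (intro D seg) auto
      ultimately have "((\<lambda>z. h (a + t *\<^sub>R (z - a))) has_derivative
          (\<lambda>v. ?D (a + t *\<^sub>R (z - a)) (t *\<^sub>R v))) (at z within ball a R)"
        by (rule has_derivative_compose)
      then have "((\<lambda>z. h (a + t *\<^sub>R (z - a))) has_derivative
          (\<lambda>v. t * ?D (a + t *\<^sub>R (z - a)) v)) (at z within ball a R)"
        using linear_scale[OF has_derivative_linear[OF D[OF seg]]] that by simp
      then show ?thesis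
        unfolding B[OF that] by (rule has_derivative_mult_right)
    qed
    have int: "(\<lambda>t. w t * h (a + t *\<^sub>R (z - a))) integrable_on cbox 0 1" if "z \<in> ball a R" for z
    proof (rule integrable_continuous)
      have "continuous_on (cbox 0 1) (Pair z)" "Pair z ` cbox 0 1 \<subseteq> ball a R \<times> cbox (0::real) 1"
        using that by (auto intro!: continuous_intros)
      from continuous_on_compose2[OF cont[OF Ck_on_imp_continuous_on[OF Suc.prems(1)] Suc.prems(2)] this]
      show "continuous_on (cbox 0 1) (\<lambda>t. w t * h (a + t *\<^sub>R (z - a)))"
        by simp
    qed
    have wt: "continuous_on {0..1} (\<lambda>t. w t * t)"
      using Suc.prems(2) by (intro continuous_intros)
    \<comment> \<open>On a finite-dimensional domain, continuity of an operator-valued map can be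
      tested on each fixed vector, that is, on directional derivatives.\<close>
    have Bc: "continuous_on (ball a R \<times> cbox 0 1) (\<lambda>(z, t). B z t)"
    proof (rule continuous_on_blinfun_componentwise)
      fix v :: 'e
      have "continuous_on (ball a R \<times> cbox 0 1) (\<lambda>(z, t). (w t * t) * ?D (a + t *\<^sub>R (z - a)) v)"
        by (rule cont[OF Dc wt])
      then show "continuous_on (ball a R \<times> cbox 0 1) (\<lambda>x. blinfun_apply (case x of (z, t) \<Rightarrow> B z t) v)"
        by (rule continuous_on_eq) (auto simp: B)
    qed
    show ?case
    proof (rule Ck_on_SucI[OF open_ball])
      fix z assume z: "z \<in> ball a R"
      have "((\<lambda>z. integral (cbox 0 1) (\<lambda>t. w t * h (a + t *\<^sub>R (z - a)))) has_derivative
          blinfun_apply (integral (cbox 0 1) (B z))) (at z within ball a R)"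
        by (rule leibniz_rule[OF fx int Bc z]) auto
      moreover have "continuous_on (cbox 0 1) (Pair z)" "Pair z ` cbox 0 1 \<subseteq> ball a R \<times> cbox (0::real) 1"
        using z by (auto intro!: continuous_intros)
      from continuous_on_compose2[OF Bc this] have "B z integrable_on cbox 0 1"
        by (intro integrable_continuous) simp
      then have "blinfun_apply (integral (cbox 0 1) (B z))
          = (\<lambda>v. integral {0..1} (\<lambda>t. (w t * t) * ?D (a + t *\<^sub>R (z - a)) v))"
        using z by (intro ext, subst blinfun_apply_integral) (auto intro!: integral_cong simp: B)
      ultimately show "((\<lambda>z. integral {0..1} (\<lambda>t. w t * h (a + t *\<^sub>R (z - a)))) has_derivative
          (\<lambda>v. integral {0..1} (\<lambda>t. (w t * t) * ?D (a + t *\<^sub>R (z - a)) v))) (at z)"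
        by (simp add: at_within_open[OF z open_ball])
    next
      show "Ck_on k (ball a R) (\<lambda>z. integral {0..1} (\<lambda>t. (w t * t) * ?D (a + t *\<^sub>R (z - a)) v))" for v
        using Suc.prems(1) by (intro Suc.IH wt) auto
    qed
  }
qed

text \<open>The increment of \<open>h\<close> is the integral of its derivative along the segment
  from \<open>a\<close> to \<open>z\<close>. Expanding the direction \<open>z - a\<close> in the
  basis leaves \<open>G b\<close>, the average of the partial derivative along \<open>b\<close> over
  the segment.\<close>

lemma hadamard:
  fixes h :: "'e::euclidean_space \<Rightarrow> real"
  assumes "smooth_on (ball a R) h" "R > 0"
  obtains G where "\<And>b. smooth_on (ball a R) (G b)"
    "\<And>b. G b a = frechet_derivative h (at a) b"
    "\<And>z. z \<in> ball a R \<Longrightarrow> h z - h a = (\<Sum>b\<in>Basis. ((z - a) \<bullet> b) * G b z)"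
proof
  let ?D = "\<lambda>z. frechet_derivative h (at z)"
  define G where "G = (\<lambda>b z. integral {0..1} (\<lambda>t. ?D (a + t *\<^sub>R (z - a)) b))"
  have Ck: "Ck_on k (ball a R) (\<lambda>z. ?D z b)" for k b
    using assms(1) unfolding smooth_on_def by (metis Ck_on.simps(2))
  show "smooth_on (ball a R) (G b)" for b
    unfolding smooth_on_def G_def
    using Ck_on_integral_segment[OF Ck, of "\<lambda>_. 1"] by simp
  show "G b a = ?D a b" for b by (simp add: G_def)
  fix z assume z: "z \<in> ball a R"
  have seg: "a + t *\<^sub>R (z - a) \<in> ball a R" if "0 \<le> t" "t \<le> 1" for t
    using that z mult_left_le_one_le[of "dist a z" t]
    by (auto simp: dist_norm norm_minus_commute)
  have D: "(h has_derivative ?D y) (at y)" if "y \<in> ball a R" for y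
    using assms(1) that unfolding smooth_on_def by (metis has_derivative_frechet)
  have "((\<lambda>t. h (a + t *\<^sub>R (z - a))) has_vector_derivative ?D (a + t *\<^sub>R (z - a)) (z - a))
      (at t within {0..1})" if "t \<in> {0..1}" for t
  proof -
    have "((\<lambda>t. a + t *\<^sub>R (z - a)) has_derivative (\<lambda>s. s *\<^sub>R (z - a))) (at t within {0..1})"
      by (auto intro!: derivative_eq_intros)
    then have "((\<lambda>t. h (a + t *\<^sub>R (z - a))) has_derivative
        (\<lambda>s. ?D (a + t *\<^sub>R (z - a)) (s *\<^sub>R (z - a)))) (at t within {0..1})"
      by (rule has_derivative_compose) (use that in \<open>auto intro: D seg\<close>)
    then show ?thesis
      using linear_scale[OF has_derivative_linear[OF D[OF seg]]] that
      by (simp add: has_vector_derivative_def)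
  qed
  then have "((\<lambda>t. ?D (a + t *\<^sub>R (z - a)) (z - a)) has_integral
      h (a + 1 *\<^sub>R (z - a)) - h (a + 0 *\<^sub>R (z - a))) {0..1}"
    by (intro fundamental_theorem_of_calculus) auto
  then have "h z - h a = integral {0..1} (\<lambda>t. ?D (a + t *\<^sub>R (z - a)) (z - a))"
    by (simp add: integral_unique)
  also have "\<dots> = integral {0..1} (\<lambda>t. \<Sum>b\<in>Basis. ((z - a) \<bullet> b) * ?D (a + t *\<^sub>R (z - a)) b)"
    by (intro integral_cong linear_eq_sum_Basis has_derivative_linear[OF D[OF seg]]) auto
  also have "\<dots> = (\<Sum>b\<in>Basis. ((z - a) \<bullet> b) * G b z)"
  proof -
    have "(\<lambda>t. ?D (a + t *\<^sub>R (z - a)) b) integrable_on {0..1}" for b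
      by (intro integrable_continuous_real continuous_on_compose2[OF Ck_on_imp_continuous_on[OF Ck[of 0 b]],
            of "{0..1}" "\<lambda>t. a + t *\<^sub>R (z - a)"] continuous_intros) (use seg in auto)
    then show ?thesis
      by (subst integral_sum) (auto simp: G_def intro: integrable_on_mult_right)
  qed
  finally show "h z - h a = (\<Sum>b\<in>Basis. ((z - a) \<bullet> b) * G b z)" .
qed

section \<open>Extending tangent vectors to vector fields\<close>

locale atlas =
  fixes A :: "('m::{t2_space,second_countable_topology}, 'e::euclidean_space) chart set"
  assumes smooth_atlas: "smooth_atlas A"
begin

lemma chart:
  assumes "(U, \<phi>) \<in> A"
  shows "open U" "open (\<phi> ` U)" "continuous_on U \<phi>" "continuous_on (\<phi> ` U) (inv_into U \<phi>)"
    "\<And>y. y \<in> U \<Longrightarrow> inv_into U \<phi> (\<phi> y) = y"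
  using assms smooth_atlas by (auto simp: smooth_atlas_def is_chart_def homeomorphism_def)

text \<open>The image is the part of the chart's range that the continuous inverse sends into
  \<open>W\<close>.\<close>

lemma open_chart_image:
  assumes "(U, \<phi>) \<in> A" "open W"
  shows "open (\<phi> ` (U \<inter> W))"
proof -
  have "\<phi> ` (U \<inter> W) = \<phi> ` U \<inter> inv_into U \<phi> -` W"
    using chart(5)[OF assms(1)] by auto
  then show ?thesis
    using continuous_open_preimage[OF chart(4,2)[OF assms(1)] assms(2)] by simp
qed

lemma Ck_on_transition:
  assumes "(U, \<phi>) \<in> A" "(V, \<psi>) \<in> A"
  shows "Ck_on k (\<phi> ` (U \<inter> V)) (\<lambda>z. \<psi> (inv_into U \<phi> z))"
  using assms smooth_atlas by (fastforce simp: smooth_atlas_def smooth_on_def comp_def)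

lemma smooth_fun_iff:
  "smooth_fun A h \<longleftrightarrow> (\<forall>U \<phi> k. (U, \<phi>) \<in> A \<longrightarrow> Ck_on k (\<phi> ` U) (\<lambda>z. h (inv_into U \<phi> z)))"
  by (auto simp: smooth_fun_def smooth_on_def comp_def)

lemma smooth_fun_const: "smooth_fun A (\<lambda>y. c)"
  by (auto simp: smooth_fun_iff intro: Ck_on_const chart)

lemma smooth_fun_add: "smooth_fun A h \<Longrightarrow> smooth_fun A h' \<Longrightarrow> smooth_fun A (\<lambda>y. h y + h' y)"
  by (auto simp: smooth_fun_iff intro: Ck_on_add chart)

lemma smooth_fun_mult: "smooth_fun A h \<Longrightarrow> smooth_fun A h' \<Longrightarrow> smooth_fun A (\<lambda>y. h y * h' y)"
  by (auto simp: smooth_fun_iff intro: Ck_on_mult chart)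

lemma smooth_fun_sum:
  "(\<And>i. i \<in> I \<Longrightarrow> smooth_fun A (F i)) \<Longrightarrow> smooth_fun A (\<lambda>y. \<Sum>i\<in>I. F i y)"
  by (auto simp: smooth_fun_iff intro: Ck_on_sum chart)

text \<open>Seen in any chart, the function is a product of smooth functions composed with a
  transition map on the open set \<open>W\<close>, and zero off \<open>K\<close>. Being a continuous
  image of the closed ball of radius \<open>r < R\<close>, \<open>K\<close> is compact, hence closed
  in the Hausdorff space, so its complement is open.\<close>

lemma smooth_fun_bump_extension:
  assumes c: "(U, \<phi>) \<in> A" and r: "0 < r" "r < R" and R: "ball a R \<subseteq> \<phi> ` U"
    and u: "smooth_on (ball a R) u"
  shows "smooth_fun A (\<lambda>y. if y \<in> U then bump a r (\<phi> y) * u (\<phi> y) else 0)"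
    (is "smooth_fun A ?E")
  unfolding smooth_fun_iff
proof (intro allI impI)
  fix V \<theta> k assume V: "(V, \<theta>) \<in> A"
  let ?\<psi> = "inv_into V \<theta>"
  define W where "W = U \<inter> \<phi> -` ball a R"
  define K where "K = inv_into U \<phi> ` cball a r"
  have "open W"
    unfolding W_def by (intro continuous_open_preimage chart[OF c] open_ball)
  have sub: "cball a r \<subseteq> ball a R" using r by auto
  have "compact K"
    unfolding K_def
    using sub R by (intro compact_continuous_image continuous_on_subset[OF chart(4)[OF c]]) auto
  then have "closed K" by (rule compact_imp_closed)
  have KW: "K \<subseteq> W"
    unfolding K_def W_def using sub R by (force simp: inv_into_into f_inv_into_f)
  let ?S1 = "\<theta> ` (V \<inter> W)" and ?S2 = "\<theta> ` (V \<inter> - K)"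
  have open1: "open ?S1" and open2: "open ?S2"
    by (intro open_chart_image[OF V] \<open>open W\<close> open_Compl \<open>closed K\<close>)+
  have "Ck_on k ?S1 (\<lambda>z. ?E (?\<psi> z))"
  proof (rule Ck_on_cong[OF open1])
    have "Ck_on k (ball a R) (\<lambda>z. bump a r z * u z)"
      using u by (intro Ck_on_mult Ck_on_bump) (auto simp: smooth_on_def)
    moreover have "Ck_on k ?S1 (\<lambda>z. \<phi> (?\<psi> z))"
      by (rule Ck_on_subset[OF Ck_on_transition[OF V c]]) (auto simp: W_def)
    moreover have "(\<lambda>z. \<phi> (?\<psi> z)) ` ?S1 \<subseteq> ball a R"
      using chart(5)[OF V] by (auto simp: W_def)
    ultimately show "Ck_on k ?S1 (\<lambda>z. bump a r (\<phi> (?\<psi> z)) * u (\<phi> (?\<psi> z)))"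
      using Ck_on_compose[OF open1] by blast
  qed (use chart(5)[OF V] in \<open>auto simp: W_def\<close>)
  moreover have "Ck_on k ?S2 (\<lambda>z. ?E (?\<psi> z))"
  proof (rule Ck_on_cong[OF open2 _ Ck_on_const[OF open2]])
    fix z assume "z \<in> ?S2"
    then have "?\<psi> z \<notin> K" using chart(5)[OF V] by auto
    then have "\<phi> (?\<psi> z) \<notin> cball a r" if "?\<psi> z \<in> U"
      using chart(5)[OF c that] unfolding K_def by (metis image_eqI)
    then show "0 = ?E (?\<psi> z)"
      using r(1) by (auto intro!: bump_eq_0)
  qed
  \<comment> \<open>\<open>K\<close> lies inside \<open>W\<close>, so the region of the product and
    the region of vanishing together cover the chart.\<close>
  moreover have "\<theta> ` V = ?S1 \<union> ?S2" using KW by auto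
  ultimately show "Ck_on k (\<theta> ` V) (\<lambda>z. ?E (?\<psi> z))"
    by (simp only: Ck_on_Un[OF open1 open2])
qed

section \<open>Tangent vectors as derivations\<close>

lemma tangent_add:
  "v \<in> tangent_space A x \<Longrightarrow> smooth_fun A h \<Longrightarrow> smooth_fun A k \<Longrightarrow> v (\<lambda>y. h y + k y) = v h + v k"
  and tangent_scale: "v \<in> tangent_space A x \<Longrightarrow> smooth_fun A h \<Longrightarrow> v (\<lambda>y. c * h y) = c * v h"
  and tangent_mult:
  "v \<in> tangent_space A x \<Longrightarrow> smooth_fun A h \<Longrightarrow> smooth_fun A k \<Longrightarrow>
     v (\<lambda>y. h y * k y) = h x * v k + k x * v h"
  and tangent_nonsmooth: "v \<in> tangent_space A x \<Longrightarrow> \<not> smooth_fun A h \<Longrightarrow> v h = 0"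
  by (auto simp: tangent_space_def)

text \<open>The product rule for 1 * 1 gives v(1) = 2 v(1), hence v(1) = 0; constants are multiples
  of 1.\<close>

lemma tangent_const:
  assumes "v \<in> tangent_space A x"
  shows "v (\<lambda>y. c) = 0"
  using tangent_mult[OF assms smooth_fun_const[of 1] smooth_fun_const[of 1]]
    tangent_scale[OF assms smooth_fun_const[of 1], of c] by simp

lemma tangent_sum:
  assumes "v \<in> tangent_space A x" "\<And>i. i \<in> I \<Longrightarrow> smooth_fun A (F i)"
  shows "v (\<lambda>y. \<Sum>i\<in>I. F i y) = (\<Sum>i\<in>I. v (F i))"
  using assms(2)
proof (induction I rule: infinite_finite_induct)
  case (insert i I)
  then show ?case
    using tangent_add[OF assms(1), of "F i" "\<lambda>y. \<Sum>i\<in>I. F i y"] smooth_fun_sum[of I F] by simp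
qed (simp_all add: tangent_const[OF assms(1)])

text \<open>A derivation acts on global functions only, whereas Hadamard's formula holds near \<open>x\<close>.
  Multiplied by the square of a bump function, it becomes a global identity whose
  right-hand side is a sum of products of global smooth functions; this shows that \<open>v\<close> is
  the directional derivative along some \<open>w\<close> in the chart.\<close>

lemma extend_tangent_vector:
  assumes v: "v \<in> tangent_space A x"
  obtains X where "vector_field A X" "X x = v"
proof -
  obtain U \<phi> where c: "(U, \<phi>) \<in> A" and xU: "x \<in> U"
  proof -
    have "x \<in> (\<Union>(U, \<phi>)\<in>A. U)"
      using smooth_atlas by (simp add: smooth_atlas_def)
    then show ?thesis using that by blast
  qed
  define \<psi> where "\<psi> = inv_into U \<phi>"
  define a where "a = \<phi> x"
  have \<psi>\<phi>: "\<psi> (\<phi> y) = y" if "y \<in> U" for y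
    using chart(5)[OF c that] by (simp add: \<psi>_def)
  obtain R where R: "R > 0" "ball a R \<subseteq> \<phi> ` U"
    using chart(2)[OF c] xU by (metis a_def imageI open_contains_ball)
  define r where "r = R / 2"
  have r: "0 < r" "r < R" using R by (auto simp: r_def)
  define E where "E = (\<lambda>u y. if y \<in> U then bump a r (\<phi> y) * u (\<phi> y) else 0)"
  have E: "smooth_fun A (E u)" if "smooth_on (ball a R) u" for u
    unfolding E_def by (rule smooth_fun_bump_extension[OF c r R(2) that])
  have Ex: "E u x = bump a r a * u a" for u using xU by (simp add: E_def a_def)
  define \<beta> where "\<beta> = bump a r a"
  have \<beta>: "\<beta> > 0" unfolding \<beta>_def by (rule bump_centre_pos[OF r(1)])
  have lin: "smooth_on (ball a R) (\<lambda>z. (z - a) \<bullet> b)" for b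
  proof -
    have "Ck_on k (ball a R) (\<lambda>z. z \<bullet> b + (- a \<bullet> b))" for k
      by (intro Ck_on_add Ck_on_const Ck_on_bounded_linear bounded_linear_inner_left open_ball)
    then show ?thesis by (simp add: smooth_on_def inner_diff_left)
  qed
  \<comment> \<open>The coordinates of \<open>w\<close> are the values of \<open>v\<close> on the
    cut-off coordinate functions. Dividing by the square of \<open>\<beta>\<close> compensates that
    cutoff and the bump factor in \<open>X\<close> below.\<close>
  define w where "w = (\<Sum>b\<in>Basis. (v (E (\<lambda>z. (z - a) \<bullet> b)) / \<beta>\<^sup>2) *\<^sub>R b)"
  define D where "D = (\<lambda>(h :: 'm \<Rightarrow> real) z. frechet_derivative (\<lambda>z. h (\<psi> z)) (at z))"
  have Ck: "Ck_on k (\<phi> ` U) (\<lambda>z. h (\<psi> z))" if "smooth_fun A h" for h k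
    using that c by (auto simp: smooth_fun_iff \<psi>_def)
  have D: "((\<lambda>z. h (\<psi> z)) has_derivative D h z) (at z)" if "smooth_fun A h" "z \<in> \<phi> ` U" for h z
    unfolding D_def by (rule has_derivative_frechet[OF Ck[OF that(1)] that(2)])
  have D_eq: "D h z = L" if "((\<lambda>z. h (\<psi> z)) has_derivative L) (at z)" for h z L
    unfolding D_def by (rule frechet_derivative_at[OF that, symmetric])
  \<comment> \<open>The field with constant coordinates \<open>w\<close> in the chart, cut off by
    the bump; the value 0 on non-smooth \<open>h\<close> is the convention for tangent
    vectors.\<close>
  define X where "X = (\<lambda>y h. if smooth_fun A h \<and> y \<in> U then bump a r (\<phi> y) * D h (\<phi> y) w else 0)"
  have "X y \<in> tangent_space A y" for y
  proof (cases "y \<in> U")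
    case True
    note D = D[OF _ imageI[OF True]]
    have "D (\<lambda>y. h y + k y) (\<phi> y) = (\<lambda>u. D h (\<phi> y) u + D k (\<phi> y) u)"
      if "smooth_fun A h" "smooth_fun A k" for h k
      by (rule D_eq, rule has_derivative_add) (intro D that)+
    moreover have "D (\<lambda>y. c * h y) (\<phi> y) = (\<lambda>u. c * D h (\<phi> y) u)"
      if "smooth_fun A h" for c h
      by (rule D_eq, rule has_derivative_mult_right) (intro D that)
    moreover have "D (\<lambda>y. h y * k y) (\<phi> y) = (\<lambda>u. h (\<psi> (\<phi> y)) * D k (\<phi> y) u + D h (\<phi> y) u * k (\<psi> (\<phi> y)))"
      if "smooth_fun A h" "smooth_fun A k" for h k
      by (rule D_eq, rule has_derivative_mult) (intro D that)+
    ultimately show ?thesis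
      using smooth_fun_add smooth_fun_mult smooth_fun_mult[OF smooth_fun_const]
      by (simp add: tangent_space_def X_def \<psi>\<phi>[OF True] algebra_simps)
  next
    case False
    then show ?thesis by (simp add: tangent_space_def X_def)
  qed
  moreover have "smooth_fun A (\<lambda>y. X y h)" if h: "smooth_fun A h" for h
  proof -
    have "Ck_on k (ball a R) (\<lambda>z. D h z w)" for k
      using Ck_on_subset[OF Ck[OF h, of "Suc k"] R(2)] by (simp add: D_def)
    moreover have "(\<lambda>y. X y h) = E (\<lambda>z. D h z w)"
      using h by (auto simp: X_def E_def)
    ultimately show ?thesis by (simp add: E smooth_on_def)
  qed
  ultimately have "vector_field A X" by (simp add: vector_field_def)
  moreover have "X x = v"
  proof
    fix h
    show "X x h = v h"
    proof (cases "smooth_fun A h")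
      case False
      then show ?thesis using tangent_nonsmooth[OF v] by (simp add: X_def)
    next
      case h: True
      have "smooth_on (ball a R) (\<lambda>z. h (\<psi> z))"
        using Ck_on_subset[OF Ck[OF h] R(2)] by (simp add: smooth_on_def)
      then obtain G where G: "\<And>b. smooth_on (ball a R) (G b)" "\<And>b. G b a = D h a b"
          "\<And>z. z \<in> ball a R \<Longrightarrow> h (\<psi> z) - h (\<psi> a) = (\<Sum>b\<in>Basis. ((z - a) \<bullet> b) * G b z)"
        using hadamard[OF _ R(1), where h = "\<lambda>z. h (\<psi> z)"] unfolding D_def by metis
      let ?u = "E (\<lambda>z. 1)" and ?l = "\<lambda>b. E (\<lambda>z. (z - a) \<bullet> b)"
      have u: "smooth_fun A ?u"
        by (rule E) (auto simp: smooth_on_def intro: Ck_on_const)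
      have eq: "?u y * ?u y * (h y + - h x) = (\<Sum>b\<in>Basis. ?l b y * E (G b) y)" for y
      proof (cases "y \<in> U \<and> \<phi> y \<in> ball a R")
        case True
        then have "h y - h x = (\<Sum>b\<in>Basis. ((\<phi> y - a) \<bullet> b) * G b (\<phi> y))"
          using G(3)[of "\<phi> y"] xU by (simp add: \<psi>\<phi> a_def)
        then show ?thesis
          using True by (simp add: E_def sum_distrib_left mult_ac)
      next
        \<comment> \<open>Both sides vanish here: \<open>E\<close> is zero off \<open>U\<close>, and
          off the ball of radius \<open>R\<close> the bump is zero because
          \<open>r < R\<close>.\<close>
        case False
        then have "E f y = 0" for f
          using r by (auto simp: E_def intro!: bump_eq_0)
        then show ?thesis by simp
      qed
      \<comment> \<open>The factor \<open>h y - h x\<close> vanishes at \<open>x\<close>, so only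
        the term of the product rule that differentiates it survives.\<close>
      have "v (\<lambda>y. ?u y * ?u y * (h y + - h x)) = \<beta>\<^sup>2 * v h"
        using tangent_mult[OF v smooth_fun_mult[OF u u] smooth_fun_add[OF h smooth_fun_const[of "- h x"]]]
          tangent_add[OF v h smooth_fun_const[of "- h x"]]
        by (simp add: tangent_const[OF v] Ex \<beta>_def power2_eq_square)
      \<comment> \<open>Each \<open>?l b\<close> vanishes at \<open>x\<close>, so the derivatives of
        \<open>G b\<close> drop out and only its value at \<open>a\<close>, a partial derivative of
        \<open>h\<close>, remains.\<close>
      moreover have "v (\<lambda>y. \<Sum>b\<in>Basis. ?l b y * E (G b) y) = (\<Sum>b\<in>Basis. \<beta> * D h a b * v (?l b))"
        using tangent_sum[OF v, of Basis "\<lambda>b y. ?l b y * E (G b) y"]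
        by (simp add: smooth_fun_mult E lin G tangent_mult[OF v] Ex \<beta>_def)
      ultimately have vh: "\<beta>\<^sup>2 * v h = (\<Sum>b\<in>Basis. \<beta> * D h a b * v (?l b))"
        by (simp only: eq)
      have "X x h = \<beta> * D h a w"
        using h xU by (simp add: X_def \<beta>_def a_def)
      also have "D h a w = (\<Sum>b\<in>Basis. (w \<bullet> b) * D h a b)"
        using xU by (intro linear_eq_sum_Basis has_derivative_linear[OF D[OF h]]) (simp add: a_def)
      also have "\<dots> = (\<Sum>b\<in>Basis. v (?l b) / \<beta>\<^sup>2 * D h a b)"
        by (intro sum.cong refl) (simp add: w_def)
      also have "\<beta> * \<dots> = (\<Sum>b\<in>Basis. \<beta> * D h a b * v (?l b)) / \<beta>\<^sup>2"
        by (simp add: sum_distrib_left sum_divide_distrib mult_ac)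
      also have "\<dots> = v h"
        using \<beta> by (simp flip: vh)
      finally show ?thesis .
    qed
  qed
  ultimately show thesis by (rule that)
qed

section \<open>Tangent spaces and Lie brackets\<close>

lemma subspace_tangent_space: "subspace (tangent_space A x)"
proof (rule subspaceI)
  show "0 \<in> tangent_space A x"
    by (simp add: tangent_space_def)
  show "u + v \<in> tangent_space A x" if "u \<in> tangent_space A x" "v \<in> tangent_space A x" for u v
    using that by (simp add: tangent_space_def algebra_simps)
  show "c *\<^sub>R u \<in> tangent_space A x" if "u \<in> tangent_space A x" for c u
    using that by (simp add: tangent_space_def scaleR_fun_def algebra_simps)
qed

lemma vector_field_tangent: "vector_field A X \<Longrightarrow> X x \<in> tangent_space A x"
  and vector_field_smooth: "vector_field A X \<Longrightarrow> smooth_fun A h \<Longrightarrow> smooth_fun A (\<lambda>x. X x h)"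
  by (auto simp: vector_field_def)

text \<open>Applying the product rule twice yields cross terms of first derivatives that are
  symmetric in \<open>X\<close> and \<open>Y\<close>; they cancel in the commutator.\<close>

lemma lie_bracket_tangent:
  assumes X: "vector_field A X" and Y: "vector_field A Y"
  shows "lie_bracket X Y x \<in> tangent_space A x"
proof -
  note T = vector_field_tangent[OF X] vector_field_tangent[OF Y]
  note S = vector_field_smooth[OF X] vector_field_smooth[OF Y]
  note simps = T[THEN tangent_add] T[THEN tangent_scale] T[THEN tangent_mult] S
    smooth_fun_add smooth_fun_mult smooth_fun_const
  \<comment> \<open>For non-smooth \<open>h\<close> the inner functions are constantly zero, and
    derivations annihilate constants.\<close>
  have "lie_bracket X Y x h = 0" if "\<not> smooth_fun A h" for h
    using that T[THEN tangent_nonsmooth] T[THEN tangent_const] by (simp add: lie_bracket_def)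
  then show ?thesis
    unfolding tangent_space_def
    by (simp add: lie_bracket_def simps algebra_simps)
qed

end

section \<open>Weak S-structures\<close>

lemma linear_between_add: "linear_between V W F \<Longrightarrow> u \<in> V \<Longrightarrow> v \<in> V \<Longrightarrow> F (u + v) = F u + F v"
  and linear_between_scale: "linear_between V W F \<Longrightarrow> v \<in> V \<Longrightarrow> F (c *\<^sub>R v) = c *\<^sub>R F v"
  and linear_between_mem: "linear_between V W F \<Longrightarrow> v \<in> V \<Longrightarrow> F v \<in> W"
  by (auto simp: linear_between_def)

lemma linear_between_0:
  assumes "linear_between V W F" "subspace V"
  shows "F 0 = 0"
  using linear_between_scale[OF assms(1) subspace_0[OF assms(2)], of 0] by simp

lemma linear_between_minus:
  assumes "linear_between V W F" "v \<in> V"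
  shows "F (- v) = - F v"
  using linear_between_scale[OF assms, of "-1"] by simp

lemma linear_between_diff:
  assumes "linear_between V W F" "subspace V" "u \<in> V" "v \<in> V"
  shows "F (u - v) = F u - F v"
  using linear_between_add[OF assms(1,3) subspace_neg[OF assms(2,4)]]
    linear_between_minus[OF assms(1,4)] by simp

lemma linear_between_sum:
  assumes "linear_between V W F" "subspace V" "\<And>i. i \<in> I \<Longrightarrow> h i \<in> V"
  shows "F (\<Sum>i\<in>I. h i) = (\<Sum>i\<in>I. F (h i))"
  using assms(3)
  by (induction I rule: infinite_finite_induct)
    (simp_all add: linear_between_0[OF assms(1,2)] linear_between_add[OF assms(1)] subspace_sum[OF assms(2)])

lemma lie_bracket_commute: "lie_bracket Y X x = - lie_bracket X Y x"
  by (simp add: lie_bracket_def fun_eq_iff)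

section \<open>The structure equations at a point\<close>

locale weak_S = atlas A
  for A :: "('m::{t2_space,second_countable_topology}, 'e::euclidean_space) chart set" +
  fixes n p :: nat and f Q :: "'m tensor11" and \<xi> :: "nat \<Rightarrow> 'm vfield"
    and \<eta> :: "nat \<Rightarrow> 'm form1" and g :: "'m tensor02"
  assumes p: "p \<ge> 1"
    and weak_S: "weak_S_structure A n p f Q \<xi> \<eta> g"
begin

abbreviation T :: "'m \<Rightarrow> 'm tvec set" where
  "T \<equiv> tangent_space A"

lemma metric_weak_f: "metric_weak_f_structure A n p f Q \<xi> \<eta> g"
  using weak_S by (simp add: weak_S_structure_def)

lemma
  shows f_linear: "linear_between (T x) (T x) (f x)"
    and Q_linear: "linear_between (T x) (T x) (Q x)"
    and f_field: "vector_field A X \<Longrightarrow> vector_field A (app f X)"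
    and Q_on_ker: "v \<in> T x \<Longrightarrow> f x v = 0 \<Longrightarrow> Q x v = v"
    and \<xi>_field: "i \<in> {1..p} \<Longrightarrow> vector_field A (\<xi> i)"
    and span_\<xi>: "span ((\<lambda>i. \<xi> i x) ` {1..p}) = {v \<in> T x. f x v = 0}"
    and f_squared: "v \<in> T x \<Longrightarrow> f x (f x v) = - Q x v + (\<Sum>i=1..p. \<eta> i x v *\<^sub>R \<xi> i x)"
    and \<eta>_\<xi>: "i \<in> {1..p} \<Longrightarrow> j \<in> {1..p} \<Longrightarrow> \<eta> i x (\<xi> j x) = (if i = j then 1 else 0)"
    and g_linear: "u \<in> T x \<Longrightarrow> linear_between (T x) UNIV (g x u)"
    and g_sym: "u \<in> T x \<Longrightarrow> v \<in> T x \<Longrightarrow> g x u v = g x v u"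
    and g_pos: "u \<in> T x \<Longrightarrow> u \<noteq> 0 \<Longrightarrow> g x u u > 0"
    and \<eta>_linear: "i \<in> {1..p} \<Longrightarrow> linear_between (T x) UNIV (\<eta> i x)"
  using metric_weak_f
  unfolding metric_weak_f_structure_def tensor11_field_def riemannian_metric_def one_form_def
  by simp_all

lemma f_cubed:
  assumes "v \<in> T x"
  shows "f x (f x (f x v)) + f x (Q x v) = 0"
proof -
  have "\<forall>x. \<forall>v\<in>T x. f x (f x (f x v)) + f x (Q x v) = 0"
    using metric_weak_f unfolding metric_weak_f_structure_def by (elim conjE)
  with assms show ?thesis by blast
qed

lemma f_mem: "v \<in> T x \<Longrightarrow> f x v \<in> T x" and Q_mem: "v \<in> T x \<Longrightarrow> Q x v \<in> T x"
  using f_linear Q_linear linear_between_mem by blast+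

lemma \<xi>_mem: "i \<in> {1..p} \<Longrightarrow> \<xi> i x \<in> T x"
  using \<xi>_field vector_field_tangent by blast

lemma f_\<xi>: "i \<in> {1..p} \<Longrightarrow> f x (\<xi> i x) = 0"
  using span_\<xi>[of x] span_superset[of "(\<lambda>i. \<xi> i x) ` {1..p}"] by blast

text \<open>The axiom speaks of vector fields; extending the two vectors to global fields yields it
  at a single point.\<close>

lemma metric_compatible:
  assumes "u \<in> T x" "v \<in> T x"
  shows "g x (f x u) (f x v) = g x u (Q x v) - (\<Sum>i=1..p. \<eta> i x u * \<eta> i x (Q x v))"
proof -
  obtain X where X: "vector_field A X" "X x = u"
    using extend_tangent_vector assms(1) by blast
  obtain Y where Y: "vector_field A Y" "Y x = v"
    using extend_tangent_vector assms(2) by blast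
  have "\<forall>X Y. vector_field A X \<longrightarrow> vector_field A Y \<longrightarrow>
      (\<forall>x. g x (f x (X x)) (f x (Y x)) =
        g x (X x) (Q x (Y x)) - (\<Sum>i=1..p. \<eta> i x (X x) * \<eta> i x (Q x (Y x))))"
    using metric_weak_f unfolding metric_weak_f_structure_def by (elim conjE)
  from this[rule_format, OF X(1) Y(1), of x] show ?thesis
    by (simp only: X Y)
qed

lemma ext_deriv_\<eta>:
  assumes "i \<in> {1..p}" "vector_field A X" "vector_field A Y"
  shows "ext_deriv (\<eta> i) X Y x = g x (X x) (f x (Y x))"
  using weak_S assms unfolding weak_S_structure_def fundamental_form_def by blast

section \<open>Consequences for \<open>f\<close> and \<open>Q\<close>\<close>

text \<open>Compatibility is evaluated with second argument \<open>\<xi> i x\<close>: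
  \<open>f\<close> kills it, \<open>Q\<close> fixes it, and duality collapses the sum to one
  term.\<close>

lemma g_\<xi>:
  assumes u: "u \<in> T x" and i: "i \<in> {1..p}"
  shows "g x u (\<xi> i x) = \<eta> i x u"
proof -
  have "g x (f x u) 0 = 0"
    by (rule linear_between_0[OF g_linear[OF f_mem[OF u]] subspace_tangent_space])
  moreover have "(\<Sum>j=1..p. \<eta> j x u * \<eta> j x (\<xi> i x)) = (\<Sum>j=1..p. if i = j then \<eta> j x u else 0)"
    by (intro sum.cong) (use i in \<open>auto simp: \<eta>_\<xi>\<close>)
  ultimately show ?thesis
    using metric_compatible[OF u \<xi>_mem[OF i]] i
    by (simp add: f_\<xi> Q_on_ker \<xi>_mem)
qed

text \<open>The exterior derivative of \<open>\<eta> 1\<close> is antisymmetric because the Lie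
  bracket is, and it equals the fundamental form; \<open>p \<ge> 1\<close> guarantees that
  \<open>\<eta> 1\<close> exists.\<close>

lemma f_skew:
  assumes "u \<in> T x" "v \<in> T x"
  shows "g x u (f x v) = - g x v (f x u)"
proof -
  obtain X where X: "vector_field A X" "X x = u"
    using extend_tangent_vector assms(1) by blast
  obtain Y where Y: "vector_field A Y" "Y x = v"
    using extend_tangent_vector assms(2) by blast
  have "ext_deriv (\<eta> 1) Y X x = - ext_deriv (\<eta> 1) X Y x"
    unfolding ext_deriv_def lie_bracket_commute[of Y X]
    using p linear_between_minus[OF \<eta>_linear lie_bracket_tangent[OF X(1) Y(1)]]
    by (simp add: field_simps)
  then show ?thesis
    using ext_deriv_\<eta>[of 1, OF _ X(1) Y(1)] ext_deriv_\<eta>[of 1, OF _ Y(1) X(1)] X Y p by simp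
qed

text \<open>Writing \<open>\<eta> i\<close> as the product with \<open>\<xi> i\<close>, skewness
  moves \<open>f\<close> onto \<open>\<xi> i\<close>, which lies in its kernel.\<close>

lemma \<eta>_f:
  assumes u: "u \<in> T x" and i: "i \<in> {1..p}"
  shows "\<eta> i x (f x u) = 0"
proof -
  have "\<eta> i x (f x u) = g x (\<xi> i x) (f x u)"
    using g_\<xi>[OF f_mem[OF u] i] g_sym[OF f_mem[OF u] \<xi>_mem[OF i]] by simp
  also have "\<dots> = - g x u (f x (\<xi> i x))"
    by (rule f_skew[OF \<xi>_mem[OF i] u])
  also have "\<dots> = 0"
    using linear_between_0[OF g_linear[OF u] subspace_tangent_space] by (simp add: f_\<xi>[OF i])
  finally show ?thesis .
qed

text \<open>Compares two evaluations of \<open>\<eta> 1\<close> on the bracket of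
  \<open>app f X\<close> and \<open>app f Y\<close>: one from the exterior derivative, the other
  from normality.\<close>

lemma \<Phi>_f_invariant:
  assumes "u \<in> T x" "v \<in> T x"
  shows "g x (f x u) (f x (f x v)) = g x u (f x v)"
proof -
  obtain X where X: "vector_field A X" "X x = u"
    using extend_tangent_vector assms(1) by blast
  obtain Y where Y: "vector_field A Y" "Y x = v"
    using extend_tangent_vector assms(2) by blast
  have 1: "1 \<in> {1..p}" using p by simp
  let ?U = "app f X" and ?W = "app f Y"
  note U = f_field[OF X(1)] and W = f_field[OF Y(1)]
  have \<eta>_app: "\<eta> 1 y (app f Z y) = 0" if "vector_field A Z" for Z y
    using \<eta>_f[OF vector_field_tangent[OF that] 1] by (simp add: app_def)
  \<comment> \<open>The other two terms of the exterior derivative differentiate functions that are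
    identically zero.\<close>
  have "ext_deriv (\<eta> 1) ?U ?W x = - \<eta> 1 x (lie_bracket ?U ?W x) / 2"
    unfolding ext_deriv_def
    using \<eta>_app[OF X(1)] \<eta>_app[OF Y(1)] tangent_const[OF vector_field_tangent[OF U]]
      tangent_const[OF vector_field_tangent[OF W]] by simp
  moreover have "ext_deriv (\<eta> 1) ?U ?W x = g x (f x u) (f x (f x v))"
    using ext_deriv_\<eta>[OF 1 U W] X Y by (simp add: app_def)
  ultimately have bracket: "\<eta> 1 x (lie_bracket ?U ?W x) = - 2 * g x (f x u) (f x (f x v))"
    by simp
  let ?a = "f x (f x (lie_bracket X Y x))" and ?b = "lie_bracket ?U ?W x"
    and ?c = "f x (lie_bracket ?U Y x)" and ?d = "f x (lie_bracket X ?W x)"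
    and ?e = "\<Sum>i=1..p. ext_deriv (\<eta> i) X Y x *\<^sub>R \<xi> i x"
  note S = subspace_tangent_space[of x]
  have e: "?e \<in> T x"
    by (intro subspace_sum[OF S] subspace_scale[OF S] \<xi>_mem)
  have ab: "?a \<in> T x" "?b \<in> T x" "?c \<in> T x" "?d \<in> T x"
    by (intro f_mem lie_bracket_tangent X Y U W)+
  have "N1 p f \<xi> \<eta> X Y = 0"
    using weak_S X Y unfolding weak_S_structure_def normal_structure_def by blast
  moreover have "N1 p f \<xi> \<eta> X Y x = ?a + ?b - ?c - ?d + 2 *\<^sub>R ?e"
    by (simp add: N1_def nijenhuis_def app_def)
  ultimately have "?a + ?b - ?c - ?d + 2 *\<^sub>R ?e = 0"
    by simp
  moreover have "\<eta> 1 x (?a + ?b - ?c - ?d + 2 *\<^sub>R ?e) = \<eta> 1 x ?a + \<eta> 1 x ?b - \<eta> 1 x ?c - \<eta> 1 x ?d + 2 *\<^sub>R \<eta> 1 x ?e"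
    using ab e
    by (simp only: linear_between_add[OF \<eta>_linear[OF 1]] linear_between_diff[OF \<eta>_linear[OF 1] S]
        linear_between_scale[OF \<eta>_linear[OF 1]] subspace_add[OF S] subspace_diff[OF S] subspace_scale[OF S])
  moreover have "\<eta> 1 x ?a = 0" "\<eta> 1 x ?c = 0" "\<eta> 1 x ?d = 0"
    by (intro \<eta>_f 1 f_mem lie_bracket_tangent X Y U W)+
  \<comment> \<open>By duality only the coefficient with index 1 survives, and it is the fundamental
    form.\<close>
  moreover have "\<eta> 1 x ?e = g x u (f x v)"
  proof -
    have "\<eta> 1 x ?e = (\<Sum>i=1..p. \<eta> 1 x (ext_deriv (\<eta> i) X Y x *\<^sub>R \<xi> i x))"
      by (intro linear_between_sum[OF \<eta>_linear[OF 1] S] subspace_scale[OF S] \<xi>_mem)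
    also have "\<dots> = (\<Sum>i=1..p. if 1 = i then g x u (f x v) else 0)"
      using X Y 1
      by (intro sum.cong refl)
        (auto simp: linear_between_scale[OF \<eta>_linear] \<xi>_mem ext_deriv_\<eta> \<eta>_\<xi>)
    finally show ?thesis using p by simp
  qed
  moreover have "\<eta> 1 x 0 = 0"
    by (rule linear_between_0[OF \<eta>_linear[OF 1] S])
  ultimately show ?thesis
    using bracket by simp
qed

text \<open>\<open>Q\<close> commutes with \<open>f\<close>, since both products equal minus the
  cube of \<open>f\<close>. Compatibility and the invariance just shown then make the difference
  \<open>?d\<close> orthogonal to itself.\<close>

lemma f_Q_eq_f:
  assumes v: "v \<in> T x"
  shows "f x (Q x v) = f x v"
proof (rule ccontr)
  note S = subspace_tangent_space[of x]
  have Qf: "Q x (f x v) = - f x (f x (f x v))"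
    using f_squared[OF f_mem[OF v]] \<eta>_f[OF v] by simp
  then have Qf': "Q x (f x v) = f x (Q x v)"
    using f_cubed[OF v] by (simp add: add_eq_0_iff2)
  \<comment> \<open>This removes the sum from the compatibility equation for
    \<open>f x v\<close>.\<close>
  have \<eta>Q: "\<eta> i x (Q x (f x v)) = 0" if "i \<in> {1..p}" for i
    unfolding Qf' using that by (intro \<eta>_f Q_mem v)
  let ?d = "f x (Q x v) - f x v"
  assume "f x (Q x v) \<noteq> f x v"
  moreover have d: "?d \<in> T x"
    by (intro subspace_diff[OF S] f_mem Q_mem v)
  ultimately have "g x ?d ?d > 0"
    using g_pos by simp
  moreover have "g x ?d (Q x (f x v)) = g x ?d (f x v)"
    using metric_compatible[OF d f_mem[OF v]] \<Phi>_f_invariant[OF d v] \<eta>Q by simp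
  then have "g x ?d ?d = 0"
    using linear_between_diff[OF g_linear[OF d] S f_mem[OF Q_mem[OF v]] f_mem[OF v]] Qf' by simp
  ultimately show False by simp
qed

text \<open>The difference \<open>?d\<close> lies in the kernel of \<open>f\<close>, which the
  \<open>\<xi> i x\<close> span, and it is orthogonal to each of them; so it is orthogonal to
  itself.\<close>

lemma Q_eq_id:
  assumes v: "v \<in> T x"
  shows "Q x v = v"
proof (rule ccontr)
  note S = subspace_tangent_space[of x]
  let ?d = "Q x v - v"
  assume "Q x v \<noteq> v"
  moreover have d: "?d \<in> T x"
    by (intro subspace_diff[OF S] Q_mem v)
  ultimately have pos: "g x ?d ?d > 0"
    using g_pos by simp
  \<comment> \<open>Applying \<open>\<eta> i\<close> to the formula for the square of
    \<open>f\<close> shows that \<open>Q x v\<close> and \<open>v\<close> have equal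
    \<open>\<eta> i\<close>, because \<open>\<eta> i\<close> vanishes on the image of
    \<open>f\<close>.\<close>
  have \<eta>d: "\<eta> i x ?d = 0" if i: "i \<in> {1..p}" for i
  proof -
    have Q: "Q x v = (\<Sum>j=1..p. \<eta> j x v *\<^sub>R \<xi> j x) - f x (f x v)"
      using f_squared[OF v] by (simp add: algebra_simps)
    have "\<eta> i x (\<Sum>j=1..p. \<eta> j x v *\<^sub>R \<xi> j x) = (\<Sum>j=1..p. \<eta> i x (\<eta> j x v *\<^sub>R \<xi> j x))"
      by (intro linear_between_sum[OF \<eta>_linear[OF i] S] subspace_scale[OF S] \<xi>_mem)
    also have "\<dots> = (\<Sum>j=1..p. if i = j then \<eta> j x v else 0)"
      using i by (intro sum.cong refl) (auto simp: linear_between_scale[OF \<eta>_linear] \<xi>_mem \<eta>_\<xi>)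
    also have "\<dots> = \<eta> i x v" using i by simp
    finally have "\<eta> i x (Q x v) = \<eta> i x v - \<eta> i x (f x (f x v))"
      unfolding Q
      by (subst linear_between_diff[OF \<eta>_linear[OF i] S])
        (auto intro!: subspace_sum[OF S] subspace_scale[OF S] \<xi>_mem f_mem v)
    then show ?thesis
      using linear_between_diff[OF \<eta>_linear[OF i] S Q_mem[OF v] v] \<eta>_f[OF f_mem[OF v] i] by simp
  qed
  have "f x ?d = 0"
    using linear_between_diff[OF f_linear S Q_mem[OF v] v] f_Q_eq_f[OF v] by simp
  then have "?d \<in> span ((\<lambda>i. \<xi> i x) ` {1..p})"
    using d span_\<xi> by simp
  \<comment> \<open>The vectors orthogonal to \<open>?d\<close> form a subspace, so orthogonality to
    the generators extends to their span.\<close>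
  moreover have "span ((\<lambda>i. \<xi> i x) ` {1..p}) \<subseteq> {z \<in> T x. g x ?d z = 0}"
  proof (rule span_minimal)
    show "subspace {z \<in> T x. g x ?d z = 0}"
      using linear_between_0[OF g_linear[OF d] S] linear_between_add[OF g_linear[OF d]]
        linear_between_scale[OF g_linear[OF d]] S
      by (auto simp: subspace_def)
    show "(\<lambda>i. \<xi> i x) ` {1..p} \<subseteq> {z \<in> T x. g x ?d z = 0}"
      using \<xi>_mem g_\<xi>[OF d] \<eta>d by auto
  qed
  ultimately have "g x ?d ?d = 0" by blast
  with pos show False by simp
qed

end

theorem theorem4p1:
  fixes A :: "('m::{t2_space,second_countable_topology}, 'e::euclidean_space) chart set"
    and n p :: nat
    and f Q :: "'m tensor11"
    and \<xi> :: "nat \<Rightarrow> 'm vfield"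
    and \<eta> :: "nat \<Rightarrow> 'm form1"
    and g :: "'m tensor02"
  assumes "smooth_manifold A (2 * n + p)"
    and "p \<ge> 1"
    and "metric_weak_f_structure A n p f Q \<xi> \<eta> g"
  shows "weak_S_structure A n p f Q \<xi> \<eta> g \<longleftrightarrow> S_structure A n p f Q \<xi> \<eta> g"
proof
  assume "weak_S_structure A n p f Q \<xi> \<eta> g"
  then interpret weak_S A n p f Q \<xi> \<eta> g
    using assms by unfold_locales (simp_all add: smooth_manifold_def)
  show "S_structure A n p f Q \<xi> \<eta> g"
    using weak_S Q_eq_id by (simp add: S_structure_def)
qed (simp add: S_structure_def)

end
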